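(* For every positive integer $N$, there exist infinitely many polynomials $P \in S_N$ such that $$\big(x^3(1 - x)^2\big)^{\lfloor N / 6 \rfloor}$$ divides $P(x)$ in $\mathbb{Z}[x]$.
   Context: For every positive integer $N$, let $\ell_N := \operatorname{lcm}\{1,2,\dots,N\}$. For a polynomial $P \in \mathbb{Z}[x]$, put $I(P) := \int_0^1 P(x)\,\mathrm{d}x$. Define $$S_N := \big\{P \in \mathbb{Z}[x] : \deg(P) < N,\ I(P) = 1/\ell_N\big\}.$$ For a real number $t$, $\lfloor t \rfloor$ denotes the largest integer not exceeding $t$.
   Formalization: For N = 1 and N = 6 exactly one such P exists (P = 1 and P = x^3(1-x)^2 respectively), so "infinitely many" is claimed only for positive integers N other than 1 and 6; for N = 1 and N = 6 only existence of such a P is claimed. *)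

theory Defs
  imports
    "HOL-Analysis.Analysis"
    "HOL-Computational_Algebra.Polynomial"
begin

definition ell :: "nat \<Rightarrow> nat" where
  "ell N = Lcm {1..N}"

definition poly_integral :: "int poly \<Rightarrow> real" where
  "poly_integral P = integral {0..1} (\<lambda>x::real. poly (map_poly real_of_int P) x)"

text \<open>The zero polynomial has \<^const>\<open>degree\<close> 0 here rather than minus infinity; this is
  immaterial, as its integral is not of the form 1 / ell N.\<close>

definition S :: "nat \<Rightarrow> int poly set" where
  "S N = {P. degree P < N \<and> poly_integral P = 1 / real (ell N)}"

end

theory Submission
  imports Defs "HOL-Computational_Algebra.Group_Closure"
    "HOL-Computational_Algebra.Primes"
begin

text \<open>
  Let \<open>m = \<lfloor>N / 6\<rfloor>\<close>. The polynomials \<open>x ^ a * (1 - x) ^ b\<close> with \<open>a \<ge> 3 m\<close>, \<open>b \<ge> 2 m\<close> and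
  \<open>a + b = N - 1\<close> are multiples of \<open>(x ^ 3 * (1 - x) ^ 2) ^ m\<close> of degree less than \<open>N\<close>. The
  integral of such a polynomial is a value of the Beta function, the reciprocal of
  \<open>d\<^sub>c = c * (N choose c)\<close>, where \<open>c\<close> may be taken to be \<open>a + 1\<close> or \<open>b + 1\<close>. Between them, these
  two choices give exactly the \<open>c\<close> with \<open>2 m < c \<le> N - 2 m\<close>.

  The integral of an integer polynomial of degree less than \<open>N\<close> lies in \<open>(1 / \<ell>\<^sub>N) \<int>\<close>, so every
  \<open>d\<^sub>c\<close> divides \<open>\<ell>\<^sub>N\<close>, and by Bezout an integer combination of these polynomials has integral
  \<open>1 / \<ell>\<^sub>N\<close> as soon as the quotients \<open>\<ell>\<^sub>N / d\<^sub>c\<close> have no common prime factor. Hence it suffices that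
  for each prime power \<open>p ^ k \<le> N\<close> some \<open>d\<^sub>c\<close> with \<open>c\<close> in the window \<open>2 m < c \<le> N - 2 m\<close> is
  divisible by \<open>p ^ k\<close> (lemma \<open>exists_prime_power_dvd_mult_choose\<close>). The window has length at
  least \<open>2 m\<close>, so a \<open>p ^ k\<close> up to its right end has a multiple in it, which is a valid \<open>c\<close>.
  For a larger \<open>p ^ k\<close> one takes for \<open>c\<close> a multiple of \<open>p ^ (k - 1)\<close> in the window; the missing factor
  \<open>p\<close> comes from \<open>N choose c\<close>, since then \<open>c\<close> and \<open>N - c\<close> are both less than \<open>p ^ k \<le> N\<close>, which
  forces a carry when they are added in base \<open>p\<close>.

  If \<open>5 m + 1 < N\<close>, then besides \<open>W = (x ^ 3 * (1 - x) ^ 2) ^ m\<close> also \<open>x * W\<close> has degree less than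
  \<open>N\<close>. A suitable nonzero combination of the two has integral zero, and its multiples can be
  added to any solution. Among the positive integers this bound excludes only \<open>1\<close> and \<open>6\<close>.
\<close>

section \<open>Integrals of integer polynomials\<close>

lemma has_integral_poly:
  "((\<lambda>x::real. poly (map_poly real_of_int P) x) has_integral
     (\<Sum>i\<le>degree P. real_of_int (coeff P i) / (real i + 1))) {0..1}"
proof -
  have "((\<lambda>x::real. x ^ i) has_integral 1 / (real i + 1)) {0..1}" for i
  proof -
    have "((\<lambda>x::real. x ^ Suc i / (real i + 1)) has_vector_derivative x ^ i)
        (at x within {0..1})" for x
      unfolding has_real_derivative_iff_has_vector_derivative [symmetric]
      by (auto intro!: derivative_eq_intros simp del: power_Suc simp: add.commute)
    from fundamental_theorem_of_calculus[OF _ this] show ?thesis by simp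
  qed
  from has_integral_mult_right[OF this]
  have "((\<lambda>x::real. real_of_int (coeff P i) * x ^ i) has_integral
      real_of_int (coeff P i) / (real i + 1)) {0..1}" for i
    by (simp only: times_divide_eq_right mult_1_right)
  from has_integral_sum[OF finite_atMost this]
  have "((\<lambda>x::real. \<Sum>i\<le>degree P. real_of_int (coeff P i) * x ^ i) has_integral
      (\<Sum>i\<le>degree P. real_of_int (coeff P i) / (real i + 1))) {0..1}" .
  thus ?thesis
    by (simp add: poly_altdef coeff_map_poly degree_map_poly)
qed

lemma poly_integral_eq_sum:
  "poly_integral P = (\<Sum>i\<le>degree P. real_of_int (coeff P i) / (real i + 1))"
  unfolding poly_integral_def using has_integral_poly by (rule integral_unique)

lemma poly_integral_diff: "poly_integral (P - Q) = poly_integral P - poly_integral Q"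
proof -
  have "map_poly real_of_int (P - Q) = map_poly real_of_int P - map_poly real_of_int Q"
    by (rule poly_eqI) (simp add: coeff_map_poly)
  hence "poly (map_poly real_of_int (P - Q))
      = (\<lambda>x. poly (map_poly real_of_int P) x - poly (map_poly real_of_int Q) x)"
    by (auto simp: fun_eq_iff)
  thus ?thesis
    unfolding poly_integral_def using has_integral_poly[of P] has_integral_poly[of Q]
    by (simp add: integral_diff has_integral_integrable_integral)
qed

lemma poly_integral_smult: "poly_integral (smult c P) = of_int c * poly_integral P"
proof -
  have "map_poly real_of_int (smult c P) = smult (of_int c) (map_poly real_of_int P)"
    by (rule poly_eqI) (simp add: coeff_map_poly)
  hence "poly (map_poly real_of_int (smult c P))
      = (\<lambda>x. of_int c * poly (map_poly real_of_int P) x)"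
    by (auto simp: fun_eq_iff)
  thus ?thesis
    unfolding poly_integral_def by simp
qed

lemma poly_integral_add: "poly_integral (P + Q) = poly_integral P + poly_integral Q"
  using poly_integral_diff[of "P + Q" Q] by simp

text \<open>
  Integrating term by term produces only the denominators \<open>1, \<dots>, N\<close>.
\<close>

lemma ell_poly_integral_in_Ints:
  assumes "degree P < N"
  shows "poly_integral P * real (ell N) \<in> \<int>"
proof -
  have "real_of_int (coeff P i) / (real i + 1) * real (ell N) \<in> \<int>" if "i \<le> degree P" for i
  proof -
    have "Suc i dvd ell N"
      unfolding ell_def using that assms by (intro dvd_Lcm) auto
    then obtain k where "ell N = Suc i * k" ..
    hence "real_of_int (coeff P i) / (real i + 1) * real (ell N)
        = of_int (coeff P i * int k)"
      by (simp add: field_simps)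
    thus ?thesis by (metis Ints_of_int)
  qed
  thus ?thesis
    unfolding poly_integral_eq_sum sum_distrib_right by (intro Ints_sum) auto
qed

abbreviation beta_poly :: "nat \<Rightarrow> nat \<Rightarrow> int poly" where
  "beta_poly a b \<equiv> [:0, 1:] ^ a * [:1, -1:] ^ b"

lemma degree_beta_poly: "degree (beta_poly a b) = a + b"
  by (simp add: degree_mult_eq degree_power_eq)

text \<open>
  The integral is the Beta function at \<open>(a + 1, b + 1)\<close>. Induction on \<open>b\<close> through
  \<open>x ^ a * (1 - x) ^ (b + 1) = x ^ a * (1 - x) ^ b - x ^ (a + 1) * (1 - x) ^ b\<close> needs only
  linearity of the integral.
\<close>

lemma poly_integral_beta_poly_fact:
  "poly_integral (beta_poly a b) = fact a * fact b / fact (a + b + 1)"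
proof (induction b arbitrary: a)
  case 0
  have "beta_poly a 0 = monom 1 a"
    by (simp add: monom_altdef)
  moreover have "(\<Sum>i\<le>a. real_of_int (coeff (monom 1 a) i) / (real i + 1))
      = (\<Sum>i\<in>{a}. 1 / (real i + 1))"
    by (intro sum.mono_neutral_cong_right) (auto simp: coeff_monom)
  ultimately show ?case
    by (simp only: poly_integral_eq_sum degree_monom_eq) (simp add: add.commute)
next
  case (Suc b)
  have "beta_poly a (Suc b) = beta_poly a b - beta_poly (Suc a) b"
  proof -
    have "[:1, -1:] = 1 - ([:0, 1:] :: int poly)"
      by (simp add: one_pCons)
    thus ?thesis by (simp add: algebra_simps)
  qed
  hence "poly_integral (beta_poly a (Suc b))
      = fact a * fact b / fact (a + b + 1) - fact (Suc a) * fact b / fact (Suc a + b + 1)"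
    by (simp only: poly_integral_diff Suc.IH)
  also have "\<dots> = fact a * fact (Suc b) / fact (a + Suc b + 1)"
  proof -
    have cancel: "x / F = (real a + real b + 2) * x / ((real a + real b + 2) * F)" for x F :: real
      by simp
    have eqs: "(fact (Suc a + b + 1) :: real) = (real a + real b + 2) * fact (a + b + 1)"
        "(fact (a + Suc b + 1) :: real) = (real a + real b + 2) * fact (a + b + 1)"
        "(fact (Suc a) :: real) = (real a + 1) * fact a"
        "(fact (Suc b) :: real) = (real b + 1) * fact b"
      by (simp_all add: algebra_simps)
    show ?thesis
      unfolding eqs cancel[of "fact a * fact b"]
      by (simp only: diff_divide_distrib [symmetric]) (simp add: algebra_simps del: fact_Suc)
  qed
  finally show ?case .
qed

lemma poly_integral_beta_poly:
  assumes "0 < c" "c \<le> n"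
  shows "poly_integral (beta_poly (c - 1) (n - c)) = 1 / real (c * (n choose c))"
    and "poly_integral (beta_poly (n - c) (c - 1)) = 1 / real (c * (n choose c))"
proof -
  have 1: "real (n choose c) = fact n / (fact c * fact (n - c))"
    using assms by (simp add: binomial_fact)
  have 2: "(fact c :: real) = real c * fact (c - 1)"
    using assms fact_reduce[of c, where 'a = real] by simp
  show "poly_integral (beta_poly (c - 1) (n - c)) = 1 / real (c * (n choose c))"
    "poly_integral (beta_poly (n - c) (c - 1)) = 1 / real (c * (n choose c))"
    using assms unfolding poly_integral_beta_poly_fact of_nat_mult 1 2
    by (simp_all add: field_simps)
qed

section \<open>Prime powers in binomial coefficients\<close>

text \<open>
  From \<open>j * (p ^ k choose j) = p ^ k * ((p ^ k - 1) choose (j - 1))\<close>: if \<open>p\<close> did not divide the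
  binomial coefficient, then \<open>p ^ k\<close> would divide \<open>j\<close>.
\<close>

lemma prime_dvd_prime_power_choose:
  fixes p :: nat
  assumes "prime p" "0 < j" "j < p ^ k"
  shows "p dvd (p ^ k choose j)"
proof (rule ccontr)
  assume "\<not> p dvd (p ^ k choose j)"
  hence "coprime (p ^ k) (p ^ k choose j)"
    using assms(1) by (simp add: prime_imp_coprime)
  moreover have "p ^ k dvd j * (p ^ k choose j)"
    using times_binomial_minus1_eq[of j "p ^ k"] assms by simp
  ultimately have "p ^ k dvd j"
    by (simp add: coprime_dvd_mult_left_iff)
  thus False using assms by (auto dest: dvd_imp_le)
qed

text \<open>
  The instance of Kummer's theorem in which \<open>c\<close> and \<open>n - c\<close> are both less than \<open>p ^ k \<le> n\<close>. Modulo
  \<open>p\<close>, \<open>(1 + x) ^ n\<close> is \<open>(1 + x ^ (p ^ k)) * (1 + x) ^ (n - p ^ k)\<close>, where the exponent \<open>c\<close> falls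
  into the gap between the low and the high terms. Vandermonde's identity expresses this for
  coefficients.
\<close>

lemma prime_dvd_choose_if_between:
  fixes p :: nat
  assumes "prime p" "p ^ k \<le> n" "n - p ^ k < c" "c < p ^ k"
  shows "p dvd (n choose c)"
proof -
  have "p dvd (p ^ k choose j) * ((n - p ^ k) choose (c - j))" if "j \<le> c" for j
  proof (cases "j = 0")
    case True
    thus ?thesis using assms by (simp add: binomial_eq_0)
  next
    case False
    thus ?thesis using assms that by (intro dvd_mult2 prime_dvd_prime_power_choose) auto
  qed
  hence "p dvd (\<Sum>j\<le>c. (p ^ k choose j) * ((n - p ^ k) choose (c - j)))"
    by (intro dvd_sum) auto
  thus ?thesis
    using assms by (simp add: vandermonde)
qed

lemma prime_power_dvd_Lcm_imp:
  fixes p :: nat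
  assumes "finite A" "prime p" "0 < k" "p ^ k dvd Lcm A"
  shows "\<exists>a\<in>A. p ^ k dvd a"
  using assms(1,4)
proof (induction A)
  case empty
  thus ?case using assms by (simp add: prime_gt_1_nat)
next
  case (insert a A)
  have "p ^ k dvd a \<or> p ^ k dvd Lcm A"
  proof (cases "a = 0 \<or> Lcm A = 0")
    case False
    moreover have "\<not> is_unit p" using assms(2) by auto
    moreover have "p ^ k dvd lcm a (Lcm A)"
      using insert.prems by simp
    ultimately show ?thesis
      using assms(2) multiplicity_lcm[of a "Lcm A" p]
      by (simp add: power_dvd_iff_le_multiplicity lcm_eq_0_iff le_max_iff_disj)
  qed auto
  thus ?case using insert.IH by auto
qed

lemma exists_multiple_in_window:
  fixes s M :: nat
  assumes "0 < s"
  shows "\<exists>c. s dvd c \<and> M < c \<and> c \<le> M + s"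
proof (intro exI conjI)
  have "s * (M div s) + M mod s = M" by simp
  moreover have "M mod s < s" using assms by simp
  ultimately show "M < s * (M div s + 1)" "s * (M div s + 1) \<le> M + s"
    unfolding distrib_left mult_1_right by linarith+
qed simp

text \<open>
  The arithmetical heart of the proof, and the place where the exponents 3 and 2 and the
  bound \<open>6 m \<le> N\<close> matter. If \<open>p ^ k\<close> is at most \<open>N - 2 m\<close>, then \<open>c\<close> itself can be
  a multiple of \<open>p ^ k\<close>. Otherwise \<open>N - 2 m < p ^ k \<le> N\<close>, every \<open>c\<close> in the window gives
  \<open>p dvd (N choose c)\<close>, and \<open>c\<close> has to contribute only \<open>p ^ (k - 1)\<close>.
\<close>

lemma exists_prime_power_dvd_mult_choose:
  fixes p m N :: nat
  assumes p: "prime p" and k: "0 < k" and le: "p ^ k \<le> N" and m: "6 * m \<le> N"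
  shows "\<exists>c. 2 * m < c \<and> c + 2 * m \<le> N \<and> p ^ k dvd c * (N choose c)"
proof (cases "p ^ k + 2 * m \<le> N")
  case True
  have "\<exists>c. p ^ k dvd c \<and> 2 * m < c \<and> c + 2 * m \<le> N"
  proof (cases "p ^ k \<le> 2 * m")
    case small: True
    \<comment> \<open>The window \<open>{2 m <.. N - 2 m}\<close> has length at least \<open>2 m\<close>, hence at least \<open>p ^ k\<close>.\<close>
    have "0 < p ^ k" using p by (simp add: prime_gt_0_nat)
    then obtain c where "p ^ k dvd c" "2 * m < c" "c \<le> 2 * m + p ^ k"
      using exists_multiple_in_window by blast
    thus ?thesis using small m by (intro exI[of _ c]) auto
  next
    case False
    thus ?thesis using True by (intro exI[of _ "p ^ k"]) auto
  qed
  thus ?thesis by (metis dvd_mult2)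
next
  case False
  define s where "s = p ^ (k - 1)"
  have ps: "p ^ k = p * s"
    using k by (cases k) (auto simp: s_def)
  have "s > 0" using p by (simp add: s_def prime_gt_0_nat)
  have "\<exists>c. s dvd c \<and> 2 * m < c \<and> c + 2 * m \<le> N"
  proof (cases "p = 2")
    case True
    \<comment> \<open>Here \<open>4 m \<le> N - 2 m < 2 s \<le> N\<close>, so \<open>s\<close> itself is in the window.\<close>
    thus ?thesis using False le m ps by (intro exI[of _ s]) auto
  next
    case False
    hence "p \<ge> 3" using prime_ge_2_nat[OF p] by simp
    hence "3 * s \<le> p ^ k" unfolding ps by simp
    moreover obtain c where "s dvd c" "2 * m < c" "c \<le> 2 * m + s"
      using exists_multiple_in_window[OF \<open>s > 0\<close>] by blast
    \<comment> \<open>From \<open>3 s \<le> N\<close> and \<open>12 m \<le> 2 N\<close> it follows that \<open>2 m + s \<le> N - 2 m\<close>.\<close>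
    ultimately show ?thesis using le m by (intro exI[of _ c]) auto
  qed
  then obtain c where c: "s dvd c" "2 * m < c" "c + 2 * m \<le> N" by blast
  moreover have "p dvd (N choose c)"
    using p le c False by (intro prime_dvd_choose_if_between[where k = k]) auto
  ultimately have "p ^ k dvd c * (N choose c)"
    unfolding ps by (metis mult.commute mult_dvd_mono)
  thus ?thesis using c by blast
qed

section \<open>Multiples with prescribed integral\<close>

text \<open>
  The exponents \<open>c - 1\<close> and \<open>N - c\<close> sum to \<open>N - 1\<close>. The larger of the two required exponents,
  \<open>3 m\<close>, is met by \<open>c - 1\<close> if \<open>c > 3 m\<close> and by \<open>N - c\<close> if \<open>c \<le> 3 m\<close>; the symmetry of the
  Beta integral makes both orders equally good.
\<close>

lemma exists_beta_poly_multiple: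
  assumes m: "6 * m \<le> N" and c: "2 * m < c" "c + 2 * m \<le> N"
  shows "\<exists>P. degree P < N \<and> ([:0, 1:] ^ 3 * [:1, -1:] ^ 2) ^ m dvd P \<and>
    poly_integral P = 1 / real (c * (N choose c))"
proof -
  have W: "([:0, 1:] ^ 3 * [:1, -1:] ^ 2 :: int poly) ^ m = beta_poly (3 * m) (2 * m)"
    by (simp add: power_mult_distrib power_mult)
  have dvd: "beta_poly (3 * m) (2 * m) dvd beta_poly a b" if "3 * m \<le> a" "2 * m \<le> b" for a b
    using that by (intro mult_dvd_mono le_imp_power_dvd)
  show ?thesis
  proof (cases "3 * m < c")
    case True
    thus ?thesis
      unfolding W using m c poly_integral_beta_poly(1)[of c N] dvd[of "c - 1" "N - c"]
      by (intro exI[of _ "beta_poly (c - 1) (N - c)"]) (auto simp: degree_beta_poly)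
  next
    case False
    thus ?thesis
      unfolding W using m c poly_integral_beta_poly(2)[of c N] dvd[of "N - c" "c - 1"]
      by (intro exI[of _ "beta_poly (N - c) (c - 1)"]) (auto simp: degree_beta_poly)
  qed
qed

text \<open>
  The values of \<open>\<ell>\<^sub>N\<close> times the integral on the admissible multiples of \<open>W\<close> form a subgroup \<open>A\<close>
  of \<open>\<int>\<close>, so \<open>A\<close> contains its greatest common divisor. A prime \<open>p\<close> dividing all of \<open>A\<close> would
  divide \<open>\<ell>\<^sub>N / d\<^sub>c\<close> also for some \<open>c\<close> such that \<open>d\<^sub>c\<close> contains the full power of \<open>p\<close> in \<open>\<ell>\<^sub>N\<close>.
\<close>

lemma exists_multiple_in_S:
  assumes N: "0 < N" and m: "6 * m \<le> N"
  shows "\<exists>P \<in> S N. ([:0, 1:] ^ 3 * [:1, -1:] ^ 2) ^ m dvd P"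
proof -
  define W :: "int poly" where "W = ([:0, 1:] ^ 3 * [:1, -1:] ^ 2) ^ m"
  define A :: "int set" where
    "A = {z. \<exists>P. degree P < N \<and> W dvd P \<and> poly_integral P * real (ell N) = of_int z}"
  have ell: "0 < ell N"
    unfolding ell_def by (auto intro!: Nat.gr0I simp: Lcm_0_iff)
  have closed: "group_closure A \<subseteq> A"
  proof
    fix z assume "z \<in> group_closure A"
    thus "z \<in> A"
    proof induction
      case (base z)
      moreover have "0 \<in> A"
        unfolding A_def using N by (auto intro!: exI[of _ 0] simp: poly_integral_eq_sum)
      ultimately show ?case by auto
    next
      case (diff z z')
      then obtain P P' where P: "degree P < N" "W dvd P" "poly_integral P * real (ell N) = of_int z"
        and P': "degree P' < N" "W dvd P'" "poly_integral P' * real (ell N) = of_int z'"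
        unfolding A_def by blast
      have "degree (P - P') < N" using P P' by (intro degree_diff_less)
      thus ?case
        unfolding A_def using P P'
        by (auto intro!: exI[of _ "P - P'"] simp: poly_integral_diff left_diff_distrib)
    qed
  qed
  have "Gcd A = 1"
  proof (rule ccontr)
    assume "Gcd A \<noteq> 1"
    then obtain p where p: "prime p" "p dvd nat (Gcd A)"
      using prime_factor_nat[of "nat (Gcd A)"] by (auto simp: nat_eq_iff)
    have "int p dvd int (nat (Gcd A))"
      using p(2) by (simp only: of_nat_dvd_iff)
    hence "int p dvd Gcd A" by simp
    hence dvd: "int p dvd z" if "z \<in> A" for z
      using Gcd_dvd[OF that] by (rule dvd_trans)
    define k where "k = multiplicity p (ell N)"
    have "\<not> is_unit p" using p(1) by auto
    hence pk: "p ^ k dvd ell N" "\<not> p ^ Suc k dvd ell N"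
      using ell power_dvd_iff_le_multiplicity[of "ell N" p "Suc k"] unfolding k_def
      by (simp_all add: multiplicity_dvd del: power_Suc)
    have key: "\<exists>z\<in>A. int (c * (N choose c)) * z = int (ell N)"
      if c: "2 * m < c" "c + 2 * m \<le> N" for c
    proof -
      obtain P where P: "degree P < N" "W dvd P" "poly_integral P = 1 / real (c * (N choose c))"
        using exists_beta_poly_multiple[OF m c] unfolding W_def by blast
      obtain z where z: "poly_integral P * real (ell N) = of_int z"
        using ell_poly_integral_in_Ints[OF P(1)] by (elim Ints_cases)
      have "real (c * (N choose c)) \<noteq> 0" using c by simp
      hence "real (ell N) = real (c * (N choose c)) * of_int z"
        using z P(3) by (simp add: field_simps)
      hence "int (ell N) = int (c * (N choose c)) * z"
        by (metis of_int_eq_iff of_int_mult of_int_of_nat_eq)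
      moreover have "z \<in> A" unfolding A_def using P z by blast
      ultimately show ?thesis by auto
    qed
    have "\<exists>c. 2 * m < c \<and> c + 2 * m \<le> N \<and> p ^ k dvd c * (N choose c)"
    proof (cases "k = 0")
      case True
      thus ?thesis using m N by (intro exI[of _ "2 * m + 1"]) auto
    next
      case False
      then obtain a where "a \<in> {1..N}" "p ^ k dvd a"
        using prime_power_dvd_Lcm_imp[of "{1..N}" p k] p(1) pk(1) unfolding ell_def by auto
      hence "p ^ k \<le> N" by (auto dest: dvd_imp_le)
      thus ?thesis using exists_prime_power_dvd_mult_choose[of p k N m] p(1) False m by simp
    qed
    then obtain c where c: "2 * m < c" "c + 2 * m \<le> N" "p ^ k dvd c * (N choose c)"
      by blast
    obtain z where z: "z \<in> A" "int (c * (N choose c)) * z = int (ell N)"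
      using key[OF c(1,2)] by blast
    have "int (p ^ k) * int p dvd int (c * (N choose c)) * z"
      using c(3) dvd[OF z(1)] by (intro mult_dvd_mono) (simp only: of_nat_dvd_iff)
    hence "p ^ Suc k dvd ell N"
      unfolding z(2) by (metis of_nat_dvd_iff of_nat_mult power_Suc2)
    with pk(2) show False by simp
  qed
  hence "1 \<in> A"
    using Gcd_in_group_closure[of A] closed by auto
  then obtain P where "degree P < N" "W dvd P" "poly_integral P * real (ell N) = 1"
    unfolding A_def by auto
  thus ?thesis
    unfolding S_def W_def using ell by (auto intro!: bexI[of _ P] simp: field_simps)
qed

lemma exists_nonzero_multiple_with_integral_zero:
  assumes "5 * m + 1 < N"
  shows "\<exists>K. K \<noteq> 0 \<and> degree K < N \<and> ([:0, 1:] ^ 3 * [:1, -1:] ^ 2) ^ m dvd K \<and>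
    poly_integral K = 0"
proof -
  define W :: "int poly" where "W = ([:0, 1:] ^ 3 * [:1, -1:] ^ 2) ^ m"
  have W: "W = beta_poly (3 * m) (2 * m)"
    by (simp add: W_def power_mult_distrib power_mult)
  have xW: "[:0, 1:] * W = beta_poly (3 * m + 1) (2 * m)"
    by (simp add: W)
  \<comment> \<open>The integral of \<open>x ^ (3 m) * (1 - x) ^ (2 m)\<close> is \<open>1 / u\<close>, and with one more factor \<open>x\<close> it is
    \<open>1 / v\<close>; the binomial form matters only in that \<open>u\<close> and \<open>v\<close> are positive integers.\<close>
  define u where "u = (5 * m + 1 - 2 * m) * ((5 * m + 1) choose (5 * m + 1 - 2 * m))"
  define v where "v = (5 * m + 2 - 2 * m) * ((5 * m + 2) choose (5 * m + 2 - 2 * m))"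
  have u: "u > 0" "poly_integral W = 1 / real u"
    using poly_integral_beta_poly(1)[of "5 * m + 1 - 2 * m" "5 * m + 1"]
    by (simp_all add: W u_def)
  have v: "v > 0" "poly_integral ([:0, 1:] * W) = 1 / real v"
    using poly_integral_beta_poly(1)[of "5 * m + 2 - 2 * m" "5 * m + 2"]
    unfolding xW by (simp_all add: v_def)
  define K where "K = smult (int u) W - smult (int v) ([:0, 1:] * W)"
  have K: "K = [:int u, - int v:] * W"
    by (simp add: K_def smult_diff_right)
  have "K \<noteq> 0"
    unfolding K W using v(1) by (intro no_zero_divisors) auto
  moreover have "degree K < N"
    using assms v(1) unfolding K W
    by (subst degree_mult_eq) (simp_all add: degree_beta_poly)
  moreover have "poly_integral K = 0"
    unfolding K_def poly_integral_diff poly_integral_smult u(2) v(2) using u(1) v(1) by simp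
  moreover have "W dvd K" unfolding K by (rule dvd_triv_right)
  ultimately show ?thesis unfolding W_def by blast
qed

theorem theorem1p4:
  fixes N :: nat
  assumes "0 < N"
  shows "(\<exists>P \<in> S N. ([:0, 1:] ^ 3 * [:1, -1:] ^ 2) ^ (N div 6) dvd P) \<and>
    (N \<noteq> 1 \<and> N \<noteq> 6 \<longrightarrow>
      infinite {P \<in> S N. ([:0, 1:] ^ 3 * [:1, -1:] ^ 2) ^ (N div 6) dvd P})"
proof (intro conjI impI)
  define W :: "int poly" where "W = ([:0, 1:] ^ 3 * [:1, -1:] ^ 2) ^ (N div 6)"
  show ex: "\<exists>P \<in> S N. ([:0, 1:] ^ 3 * [:1, -1:] ^ 2) ^ (N div 6) dvd P"
    using exists_multiple_in_S[OF assms, of "N div 6"] by simp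
  assume "N \<noteq> 1 \<and> N \<noteq> 6"
  hence "5 * (N div 6) + 1 < N" using assms by presburger
  then obtain K where K: "K \<noteq> 0" "degree K < N" "W dvd K" "poly_integral K = 0"
    using exists_nonzero_multiple_with_integral_zero unfolding W_def by blast
  obtain P where P: "P \<in> S N" "W dvd P"
    using ex unfolding W_def by blast
  define f where "f t = P + smult (int t) K" for t
  have "inj f"
    using K(1) by (auto simp: inj_def f_def poly_eq_iff)
  hence "infinite (range f)" by (rule range_inj_infinite)
  moreover have "f t \<in> {P \<in> S N. W dvd P}" for t
  proof -
    have "degree (f t) < N"
      unfolding f_def using P K by (intro degree_add_less) (auto simp: S_def degree_smult_eq)
    thus ?thesis
      using P K by (auto simp: f_def S_def poly_integral_add poly_integral_smult dvd_smult)
  qed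
  hence "range f \<subseteq> {P \<in> S N. W dvd P}" by blast
  ultimately show "infinite {P \<in> S N. ([:0, 1:] ^ 3 * [:1, -1:] ^ 2) ^ (N div 6) dvd P}"
    unfolding W_def using infinite_super by blast
qed

end
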